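(* Let $F$ be a CNF formula with $n$ variables and $m$ clauses, and consider its clause-literal graph with vertices numbered by $[2n+m]$ so that the $2n$ literal vertices are numbered $1,\dots,2n$ and the $m$ clause vertices are numbered $2n+1,\dots,2n+m$. Among all such numberings, consider one whose adjacency matrix $A$ is lexicographically minimal (comparing the vectors obtained by concatenating the rows of the adjacency matrix). Then for all $i,j\leq 2n$ we have $A_{i,j}=1$ if and only if $i+j=2n+1$. Equivalently, for each variable, its positive and negative literal are numbered $j$ and $2n+1-j$ for some $j\in[n]$.
   Context: A literal is a propositional variable $x$ or its negation $\overline{x}$; a clause is a finite set of literals not containing both a literal and its negation; a CNF formula is a finite set of clauses. The clause-literal graph of $F$ is the undirected graph whose vertex set is the disjoint union of the set of literals of $F$ (both $x$ and $\overline{x}$ for every variable $x$ of $F$) and the set of clauses of $F$, with edges $\{x,\overline{x}\}$ for each variable $x$ of $F$ and $\{C,\ell\}$ for each clause $C\in F$ and literal $\ell\in C$. The adjacency matrix $A$ of a graph on vertex set $[N]$ has $A_{u,v}=1$ iff $uv$ is an edge. *)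

theory Defs
  imports Main
begin

datatype 'a literal = Pos (var_of: 'a) | Neg (var_of: 'a)

type_synonym 'a clause = "'a literal set"

definition is_clause :: "'a clause \<Rightarrow> bool" where
  "is_clause C \<longleftrightarrow> finite C \<and> (\<forall>x. \<not> (Pos x \<in> C \<and> Neg x \<in> C))"

definition is_cnf :: "'a clause set \<Rightarrow> bool" where
  "is_cnf F \<longleftrightarrow> finite F \<and> (\<forall>C\<in>F. is_clause C)"

definition vars :: "'a clause set \<Rightarrow> 'a set" where
  "vars F = var_of ` \<Union>F"

(* Both literals of each variable of F, even if only one of them occurs in a clause. *)
definition lits :: "'a clause set \<Rightarrow> 'a literal set" where
  "lits F = Pos ` vars F \<union> Neg ` vars F"

type_synonym 'a vertex = "'a literal + 'a clause"

definition clg_edges :: "'a clause set \<Rightarrow> 'a vertex set set" where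
  "clg_edges F = {{Inl (Pos x), Inl (Neg x)} |x. x \<in> vars F} \<union>
     {{Inr C, Inl l} |C l. C \<in> F \<and> l \<in> C}"

(* A numbering sends vertices to numbers. The two vertex classes are disjoint, so the two
   conditions together make it a bijection from all vertices onto {1..2n+m}. *)
definition is_numbering :: "'a clause set \<Rightarrow> ('a vertex \<Rightarrow> nat) \<Rightarrow> bool" where
  "is_numbering F \<nu> \<longleftrightarrow>
     bij_betw \<nu> (Inl ` lits F) {1..2 * card (vars F)} \<and>
     bij_betw \<nu> (Inr ` F) {2 * card (vars F) + 1..2 * card (vars F) + card F}"

(* Matrices are indexed from 1; only indices in {1..N} are meaningful for a graph on {1..N}. *)
definition adj_matrix :: "nat set set \<Rightarrow> nat \<Rightarrow> nat \<Rightarrow> nat" where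
  "adj_matrix E i j = (if {i, j} \<in> E then 1 else 0)"

definition concat_rows :: "nat \<Rightarrow> (nat \<Rightarrow> nat \<Rightarrow> nat) \<Rightarrow> nat list" where
  "concat_rows N A = concat (map (\<lambda>i. map (A i) [1..<N + 1]) [1..<N + 1])"

(* Adjacency matrix of the clause-literal graph with each vertex v renamed to \<nu> v. *)
definition clg_matrix :: "'a clause set \<Rightarrow> ('a vertex \<Rightarrow> nat) \<Rightarrow> nat \<Rightarrow> nat \<Rightarrow> nat" where
  "clg_matrix F \<nu> = adj_matrix ((`) \<nu> ` clg_edges F)"

definition clg_vector :: "'a clause set \<Rightarrow> ('a vertex \<Rightarrow> nat) \<Rightarrow> nat list" where
  "clg_vector F \<nu> = concat_rows (2 * card (vars F) + card F) (clg_matrix F \<nu>)"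

definition lex_minimal_numbering :: "'a clause set \<Rightarrow> ('a vertex \<Rightarrow> nat) \<Rightarrow> bool" where
  "lex_minimal_numbering F \<nu> \<longleftrightarrow> is_numbering F \<nu> \<and>
     (\<forall>\<mu>. is_numbering F \<mu> \<longrightarrow> \<not> ord_class.lexordp (clg_vector F \<mu>) (clg_vector F \<nu>))"

end

(* If row i is the first whose literal partner p is not 2n+1-i, then p < 2n+1-i because the
   larger positions are the partners of the earlier rows. Exchanging the numbers p and 2n+1-i
   leaves all earlier rows unchanged and moves the 1 in row i to the right, which makes the
   matrix lexicographically smaller. *)

theory Submission
  imports Defs "HOL-Combinatorics.Transposition"
begin

text \<open>Rows before \<open>i\<close> and the entries of row \<open>i\<close> before column
  \<open>p\<close> form a common prefix of the two vectors, so entry \<open>(i, p)\<close> decides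
  the comparison. Everything after it is unconstrained.\<close>

lemma lexordp_concat_rows:
  assumes "i \<in> {1..N}" "p \<in> {1..N}"
    and rows: "\<And>k j. k < i \<Longrightarrow> j \<in> {1..N} \<Longrightarrow> 1 \<le> k \<Longrightarrow> B k j = A k j"
    and row: "\<And>j. j < p \<Longrightarrow> 1 \<le> j \<Longrightarrow> B i j = A i j"
    and less: "B i p < A i p"
  shows "ord_class.lexordp (concat_rows N B) (concat_rows N A)"
proof -
  have split: "[1..<N + 1] = [1..<k] @ k # [k + 1..<N + 1]" if "k \<in> {1..N}" for k
    using that upt_add_eq_append[of 1 k "N + 1 - k"] by (simp add: upt_conv_Cons)
  have 1: "concat_rows N M = concat (map (\<lambda>k. map (M k) [1..<N + 1]) [1..<i]) @ map (M i) [1..<p]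
      @ M i p # (map (M i) [p + 1..<N + 1] @ concat (map (\<lambda>k. map (M k) [1..<N + 1]) [i + 1..<N + 1]))"
    for M
  proof -
    \<comment> \<open>Only the list of row indices is split here; the columns are split afterwards,
      in row \<open>i\<close> alone.\<close>
    have "concat_rows N M = concat (map (\<lambda>k. map (M k) [1..<N + 1]) [1..<i])
      @ map (M i) [1..<N + 1] @ concat (map (\<lambda>k. map (M k) [1..<N + 1]) [i + 1..<N + 1])"
      unfolding concat_rows_def by (subst (2) split[OF assms(1)]) simp
    also have "map (M i) [1..<N + 1] = map (M i) [1..<p] @ M i p # map (M i) [p + 1..<N + 1]"
      by (subst split[OF assms(2)]) simp
    finally show ?thesis by simp
  qed
  have "map (\<lambda>k. map (B k) [1..<N + 1]) [1..<i] = map (\<lambda>k. map (A k) [1..<N + 1]) [1..<i]"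
    using rows by (auto intro!: map_cong)
  moreover have "map (B i) [1..<p] = map (A i) [1..<p]"
    using row by auto
  ultimately show ?thesis
    unfolding 1 by (simp only:) (intro lexordp_append_leftI ord_class.lexordp.intros(2) less)
qed

text \<open>Renumbering by a permutation acts on matrix indices by its inverse. A transposition is
  its own inverse, so the same map appears on the right.\<close>

lemma clg_matrix_transpose:
  "clg_matrix F (transpose p q \<circ> \<nu>) i j = clg_matrix F \<nu> (transpose p q i) (transpose p q j)"
proof -
  have flip: "{i, j} = transpose p q ` S \<longleftrightarrow> {transpose p q i, transpose p q j} = S" for S
  proof -
    have "transpose p q ` transpose p q ` T = T" for T
      by (simp add: image_comp)
    moreover have "{transpose p q i, transpose p q j} = transpose p q ` {i, j}"
      by simp
    ultimately show ?thesis
      by metis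
  qed
  have "{i, j} \<in> (`) (transpose p q \<circ> \<nu>) ` clg_edges F \<longleftrightarrow>
      (\<exists>e\<in>clg_edges F. {i, j} = transpose p q ` (\<nu> ` e))"
    by (simp only: image_iff image_comp)
  also have "\<dots> \<longleftrightarrow> {transpose p q i, transpose p q j} \<in> (`) \<nu> ` clg_edges F"
    by (simp only: flip image_iff)
  finally show ?thesis
    unfolding clg_matrix_def adj_matrix_def by presburger
qed

lemma is_numbering_transpose:
  assumes "is_numbering F \<nu>" "p \<in> {1..2 * card (vars F)}" "q \<in> {1..2 * card (vars F)}"
  shows "is_numbering F (transpose p q \<circ> \<nu>)"
proof -
  \<comment> \<open>This covers both blocks of a numbering: the literal positions contain both
    \<open>p\<close> and \<open>q\<close>, the clause positions neither.\<close>
  have "bij_betw (transpose p q) S S" if "p \<in> S \<longleftrightarrow> q \<in> S" for S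
    using that by (auto simp: bij_betw_def transpose_image_eq)
  then show ?thesis
    using assms unfolding is_numbering_def by (auto intro!: bij_betw_trans)
qed

text \<open>Every clause-literal edge has an end numbered above \<open>2 * card (vars F)\<close>, so
  within the literal block only the edges joining complementary literals remain.\<close>

lemma clg_matrix_literals:
  assumes "is_numbering F \<nu>" "i \<in> {1..2 * card (vars F)}" "j \<in> {1..2 * card (vars F)}"
  shows "clg_matrix F \<nu> i j = 1 \<longleftrightarrow> (\<exists>x\<in>vars F. {i, j} = {\<nu> (Inl (Pos x)), \<nu> (Inl (Neg x))})"
proof -
  have clause: "\<nu> (Inr C) > 2 * card (vars F)" if "C \<in> F" for C
    using assms(1) that bij_betwE[of \<nu> "Inr ` F"] unfolding is_numbering_def by fastforce
  have "{i, j} \<noteq> {\<nu> (Inr C), \<nu> (Inl l)}" if "C \<in> F" for C l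
    using assms(2,3) clause[OF that] by (auto simp: doubleton_eq_iff)
  moreover have "{i, j} \<in> (`) \<nu> ` clg_edges F \<longleftrightarrow>
      (\<exists>x\<in>vars F. {i, j} = {\<nu> (Inl (Pos x)), \<nu> (Inl (Neg x))}) \<or>
      (\<exists>C\<in>F. \<exists>l\<in>C. {i, j} = {\<nu> (Inr C), \<nu> (Inl l)})"
  proof -
    have "{i, j} \<in> (`) \<nu> ` clg_edges F \<longleftrightarrow> (\<exists>e\<in>clg_edges F. {i, j} = \<nu> ` e)"
      by (simp only: image_iff)
    also have "\<dots> \<longleftrightarrow> (\<exists>x\<in>vars F. {i, j} = \<nu> ` {Inl (Pos x), Inl (Neg x)}) \<or>
        (\<exists>C\<in>F. \<exists>l\<in>C. {i, j} = \<nu> ` {Inr C, Inl l})"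
      unfolding clg_edges_def by blast
    finally show ?thesis
      by simp
  qed
  ultimately have "{i, j} \<in> (`) \<nu> ` clg_edges F \<longleftrightarrow>
      (\<exists>x\<in>vars F. {i, j} = {\<nu> (Inl (Pos x)), \<nu> (Inl (Neg x))})"
    by metis
  then show ?thesis
    unfolding clg_matrix_def adj_matrix_def by presburger
qed

lemma clg_matrix_sym: "clg_matrix F \<nu> i j = clg_matrix F \<nu> j i"
  unfolding clg_matrix_def adj_matrix_def by (simp add: insert_commute)

lemma numbering_literal_eq:
  assumes "is_numbering F \<nu>" "x \<in> vars F" "y \<in> vars F"
  shows "\<nu> (Inl (Pos x)) \<noteq> \<nu> (Inl (Neg y))"
    and "\<nu> (Inl (Pos x)) = \<nu> (Inl (Pos y)) \<longleftrightarrow> x = y"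
    and "\<nu> (Inl (Neg x)) = \<nu> (Inl (Neg y)) \<longleftrightarrow> x = y"
proof -
  have "inj_on \<nu> (Inl ` lits F)"
    using assms(1) unfolding is_numbering_def bij_betw_def by blast
  then show "\<nu> (Inl (Pos x)) \<noteq> \<nu> (Inl (Neg y))"
    and "\<nu> (Inl (Pos x)) = \<nu> (Inl (Pos y)) \<longleftrightarrow> x = y"
    and "\<nu> (Inl (Neg x)) = \<nu> (Inl (Neg y)) \<longleftrightarrow> x = y"
    using assms(2,3) by (auto simp: lits_def inj_on_eq_iff)
qed

text \<open>Complementary pairs form a perfect matching on the literals, so each row of the literal
  block has a single 1. Its column is called the partner of the row.\<close>

lemma clg_matrix_partner_ex1:
  assumes "is_numbering F \<nu>" "i \<in> {1..2 * card (vars F)}"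
  shows "\<exists>!j. j \<in> {1..2 * card (vars F)} \<and> clg_matrix F \<nu> i j = 1"
proof -
  have img: "\<nu> ` Inl ` lits F = {1..2 * card (vars F)}"
    using assms(1) unfolding is_numbering_def bij_betw_def by blast
  have lit: "\<nu> (Inl (Pos x)) \<in> {1..2 * card (vars F)}" "\<nu> (Inl (Neg x)) \<in> {1..2 * card (vars F)}"
    if "x \<in> vars F" for x
    using that unfolding img[symmetric] lits_def by auto
  from assms(2) obtain x where x: "x \<in> vars F" "i = \<nu> (Inl (Pos x)) \<or> i = \<nu> (Inl (Neg x))"
    unfolding img[symmetric] lits_def by auto
  \<comment> \<open>The flipped instance serves the case where \<open>i\<close> is the number of a
    negative literal: it excludes the crossed way of equating the two doubletons.\<close>
  note neq = numbering_literal_eq[OF assms(1) x(1)]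
    numbering_literal_eq(1)[OF assms(1) _ x(1), THEN not_sym]
  have "\<exists>k\<in>{1..2 * card (vars F)}. \<forall>j.
      (\<exists>y\<in>vars F. {i, j} = {\<nu> (Inl (Pos y)), \<nu> (Inl (Neg y))}) \<longleftrightarrow> j = k"
    using x(2)
  proof
    assume i: "i = \<nu> (Inl (Pos x))"
    have "(\<exists>y\<in>vars F. {i, j} = {\<nu> (Inl (Pos y)), \<nu> (Inl (Neg y))}) \<longleftrightarrow> j = \<nu> (Inl (Neg x))" for j
      unfolding i doubleton_eq_iff using x(1) neq by blast
    then show ?thesis using lit(2)[OF x(1)] by blast
  next
    assume i: "i = \<nu> (Inl (Neg x))"
    have "(\<exists>y\<in>vars F. {i, j} = {\<nu> (Inl (Pos y)), \<nu> (Inl (Neg y))}) \<longleftrightarrow> j = \<nu> (Inl (Pos x))" for j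
      unfolding i doubleton_eq_iff using x(1) neq by blast
    then show ?thesis using lit(1)[OF x(1)] by blast
  qed
  then show ?thesis
    using clg_matrix_literals[OF assms] by metis
qed

lemma clg_matrix_neq_1: "clg_matrix F \<nu> i j \<noteq> 1 \<longleftrightarrow> clg_matrix F \<nu> i j = 0"
  unfolding clg_matrix_def adj_matrix_def by simp

text \<open>Only the first half of the literal rows needs the exchange argument; symmetry of the
  matrix yields the other half. The induction is strong because the partners of all earlier rows are
  needed to locate that of row \<open>i\<close>.\<close>

lemma lex_minimal_partner:
  assumes min: "lex_minimal_numbering F \<nu>" and "1 \<le> i" "i \<le> card (vars F)"
  shows "clg_matrix F \<nu> i (2 * card (vars F) + 1 - i) = 1"
  using assms(2,3)
proof (induction i rule: less_induct)
  case (less i)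
  define n where "n = card (vars F)"
  define A where "A = clg_matrix F \<nu>"
  define q where "q = 2 * n + 1 - i"
  have num: "is_numbering F \<nu>"
    using min unfolding lex_minimal_numbering_def by blast
  have unique: "j = j'"
    if "A k j = 1" "A k j' = 1" "k \<in> {1..2 * n}" "j \<in> {1..2 * n}" "j' \<in> {1..2 * n}" for k j j'
    using clg_matrix_partner_ex1[OF num, of k] that unfolding A_def n_def by blast
  have sym: "A k j = A j k" for k j
    unfolding A_def by (rule clg_matrix_sym)
  have i: "1 \<le> i" "i \<le> n"
    using less.prems by (auto simp: n_def)
  have IH: "A k (2 * n + 1 - k) = 1" if "1 \<le> k" "k < i" for k
    using less.IH[of k] that i by (auto simp: A_def n_def)
  obtain p where p: "p \<in> {1..2 * n}" "A i p = 1"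
    using clg_matrix_partner_ex1[OF num, of i] i unfolding A_def n_def by auto
  have "p = q"
  proof (rule ccontr)
    assume "p \<noteq> q"
    have "i \<noteq> p"
    proof
      assume "i = p"
      then obtain x where "x \<in> vars F" "{i, i} = {\<nu> (Inl (Pos x)), \<nu> (Inl (Neg x))}"
        using p i clg_matrix_literals[OF num, of i i] unfolding A_def n_def by auto
      then show False
        using numbering_literal_eq(1)[OF num] by (metis doubleton_eq_iff)
    qed
    \<comment> \<open>An earlier row \<open>p\<close> already has partner
      \<open>2 * n + 1 - p\<close>, so \<open>i\<close> would equal it. But \<open>p < i\<close> and
      \<open>i \<le> n\<close> make \<open>i + p\<close> too small.\<close>
    moreover have "\<not> p < i"
    proof
      assume "p < i"
      then have "i = 2 * n + 1 - p"
        using p i IH[of p] sym[of i p] by - (rule unique[of p], auto)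
      with \<open>p < i\<close> i show False by linarith
    qed
    ultimately have "i < p" by simp
    \<comment> \<open>A column beyond \<open>q\<close> has the form \<open>2 * n + 1 - k\<close>
      with \<open>k < i\<close>, hence is already the partner of row \<open>k\<close> and cannot
      also be that of row \<open>i\<close>.\<close>
    have "p < q"
    proof (rule ccontr)
      assume "\<not> p < q"
      define k where "k = 2 * n + 1 - p"
      have k: "1 \<le> k" "k < i" "p = 2 * n + 1 - k"
        using \<open>\<not> p < q\<close> \<open>p \<noteq> q\<close> p i by (auto simp: k_def q_def)
      then have "k = i"
        using p i IH[of k] sym[of p] by - (rule unique[of p], auto)
      with k show False by simp
    qed
    have q: "q \<in> {1..2 * n}"
      using i by (auto simp: q_def)
    define B where "B = clg_matrix F (transpose p q \<circ> \<nu>)"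
    have B: "B k j = A (transpose p q k) (transpose p q j)" for k j
      unfolding B_def A_def by (rule clg_matrix_transpose)
    \<comment> \<open>The only literal column with a 1 in row \<open>k\<close> is
      \<open>2 * n + 1 - k\<close>, which lies to the right of \<open>q\<close> and hence of
      \<open>p\<close>.\<close>
    have earlier: "A k p = 0" "A k q = 0" if "1 \<le> k" "k < i" for k
    proof -
      have "2 * n + 1 - k > q"
        using that i by (auto simp: q_def)
      moreover have "j = 2 * n + 1 - k" if "A k j = 1" "j \<in> {1..2 * n}" for j
        by (rule unique[OF that(1) IH]) (use that(2) \<open>1 \<le> k\<close> \<open>k < i\<close> i in auto)
      ultimately have "A k p \<noteq> 1" "A k q \<noteq> 1"
        using p q \<open>p < q\<close> by (metis less_asym, metis less_irrefl)
      then show "A k p = 0" "A k q = 0"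
        unfolding A_def clg_matrix_neq_1 by auto
    qed
    have "A i q \<noteq> 1"
      using unique[of i p q] p q i \<open>p \<noteq> q\<close> by auto
    then have "A i q = 0"
      unfolding A_def clg_matrix_neq_1 .
    have "ord_class.lexordp (concat_rows (2 * n + card F) B) (concat_rows (2 * n + card F) A)"
    proof (rule lexordp_concat_rows[of i _ p])
      \<comment> \<open>Since \<open>k < i < p < q\<close>, the swap fixes the row index and
        exchanges only two zero entries. All other columns, including those of clauses, stay in
        place.\<close>
      show "B k j = A k j" if "k < i" "1 \<le> k" for k j
        using that \<open>i < p\<close> \<open>p < q\<close> earlier[of k] unfolding B by (auto simp: transpose_def)
      show "B i j = A i j" if "j < p" for j
        using that \<open>i < p\<close> \<open>p < q\<close> unfolding B by (auto simp: transpose_def)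
      \<comment> \<open>Row \<open>i\<close> is itself fixed, so its entry at \<open>p\<close>
        becomes the old entry at \<open>q\<close>: a 0 replaces a 1.\<close>
      show "B i p < A i p"
        using \<open>A i q = 0\<close> p \<open>i < p\<close> \<open>p < q\<close> unfolding B by (auto simp: transpose_def)
    qed (use i p in auto)
    moreover have "is_numbering F (transpose p q \<circ> \<nu>)"
      using is_numbering_transpose[OF num] p q unfolding n_def by blast
    ultimately show False
      using min unfolding lex_minimal_numbering_def clg_vector_def A_def B_def n_def by blast
  qed
  with p show ?case
    by (simp add: A_def q_def n_def)
qed

theorem theorem1:
  fixes F :: "'a clause set" and n m :: nat and \<nu> :: "'a vertex \<Rightarrow> nat"
    and A :: "nat \<Rightarrow> nat \<Rightarrow> nat"
  assumes "is_cnf F"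
    and "card (vars F) = n"
    and "card F = m"
    and "lex_minimal_numbering F \<nu>"
    and "A = clg_matrix F \<nu>"
  shows "(\<forall>i\<in>{1..2 * n}. \<forall>j\<in>{1..2 * n}. A i j = 1 \<longleftrightarrow> i + j = 2 * n + 1) \<and>
    (\<forall>x\<in>vars F. \<exists>j\<in>{1..n}. {\<nu> (Inl (Pos x)), \<nu> (Inl (Neg x))} = {j, 2 * n + 1 - j})"
proof -
  have num: "is_numbering F \<nu>"
    using assms(4) unfolding lex_minimal_numbering_def by blast
  have antidiagonal: "A i (2 * n + 1 - i) = 1" if i: "i \<in> {1..2 * n}" for i
  proof (cases "i \<le> n")
    case True
    then show ?thesis
      using lex_minimal_partner[OF assms(4), of i] i by (simp add: assms(2,5))
  next
    case False
    \<comment> \<open>For \<open>i > n\<close> the mirrored index \<open>2 * n + 1 - i\<close> lies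
      in the first half, and its entry is reflected across the main diagonal.\<close>
    then have "A (2 * n + 1 - i) (2 * n + 1 - (2 * n + 1 - i)) = 1"
      using lex_minimal_partner[OF assms(4), of "2 * n + 1 - i"] i by (simp add: assms(2,5))
    then show ?thesis
      using i clg_matrix_sym[of F \<nu> i] by (simp add: assms(5))
  qed
  have A_iff: "A i j = 1 \<longleftrightarrow> i + j = 2 * n + 1" if ij: "i \<in> {1..2 * n}" "j \<in> {1..2 * n}" for i j
  proof -
    have "2 * n + 1 - i \<in> {1..2 * n}" using ij by auto
    \<comment> \<open>The antidiagonal entry uses up the single 1 that row \<open>i\<close> has in
      the literal block.\<close>
    then have "A i j = 1 \<longleftrightarrow> j = 2 * n + 1 - i"
      using clg_matrix_partner_ex1[OF num, of i] antidiagonal[of i] ij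
      unfolding assms(2,5) by blast
    then show ?thesis using ij by auto
  qed
  moreover have "\<exists>j\<in>{1..n}. {\<nu> (Inl (Pos x)), \<nu> (Inl (Neg x))} = {j, 2 * n + 1 - j}"
    if x: "x \<in> vars F" for x
  proof -
    define a b where "a = \<nu> (Inl (Pos x))" and "b = \<nu> (Inl (Neg x))"
    have ab: "a \<in> {1..2 * n}" "b \<in> {1..2 * n}"
      using num x unfolding is_numbering_def assms(2) a_def b_def lits_def
      by (auto dest: bij_betwE)
    then have "A a b = 1"
      using clg_matrix_literals[OF num, of a b] x unfolding assms(2,5) a_def b_def by blast
    with ab A_iff have "a + b = 2 * n + 1" by blast
    \<comment> \<open>Either literal may carry the smaller number, so the witness is the minimum. It
      is at most \<open>n\<close> because the two numbers sum to \<open>2 * n + 1\<close>.\<close>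
    then have "min a b \<in> {1..n}" "{a, b} = {min a b, 2 * n + 1 - min a b}"
      using ab by (auto simp: min_def)
    then show ?thesis unfolding a_def b_def by blast
  qed
  ultimately show ?thesis by blast
qed

end
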